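(* Let $C>0$ and $k>1$. Consider the LMP game on the following network. There are two nodes, joined by one line of admittance $Y_{12}>0$ and capacity $C$. There are four generators: generators $1$ and $4$ at node $1$, and generators $2$ and $3$ at node $2$. The demands are $D_1=2C$ and $D_2=0$. The cost functions are $c_1(x_1)=x_1$, $c_2(x_2)=kx_2$, $c_3(x_3)=kx_3$, $c_4(x_4)=2kx_4$. Then the price of anarchy of this LMP game satisfies $$\mathrm{PoA}\ \ge\ \frac{k+1}{2}.$$ Consequently, letting $k\to\infty$, the price of anarchy in the LMP game can be arbitrarily large.
   Context: Network: a connected power network with nodes $i=1,\dots,I$; line $i$-$j$ has admittance $Y_{ij}=Y_{ji}>0$ ($Y_{ij}=0$ if there is no line) and capacity $C_{ij}=C_{ji}>0$. There are generators $n=1,\dots,N$; $\mathcal N_i$ is the set of generators at node $i$; generator $n$ has cost function $c_n:\mathbb R_+\to\mathbb R_+$ with $c_n(0)=0$, $c_n'\ge 0$, $c_n''\ge 0$. Node $i$ has inelastic demand $D_i\ge 0$. Economic dispatch problem: minimize $\sum_n c_n(x_n)$ over $x_n,\theta_i\in\mathbb R$ subject to $\sum_{n\in\mathcal N_i}x_n-D_i=\sum_jY_{ij}(\theta_i-\theta_j)$ for all $i$; $Y_{ij}(\theta_i-\theta_j)\le C_{ij}$ for all ordered pairs $(i,j)$ joined by a line; $x_n\ge0$ for all $n$. Its optimal dispatch is denoted $x^*$. LMP game. Each generator $n$ submits a bid $(p_n,s_n,q_n)$ with $0\le p_n\le q_n$, $s_n\ge0$, identified with the function $b_n(x_n)=p_nx_n$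 for $x_n\le s_n$ and $b_n(x_n)=q_nx_n+(p_n-q_n)s_n$ for $x_n>s_n$. Given the bid profile $b=(b_1,\dots,b_N)$, the dispatch $x$ is (the $x$-part of) an optimal solution $(x,\theta)$ of the economic dispatch problem with each $c_n$ replaced by $b_n$. The locational marginal prices (LMPs) $\pi=(\pi_i)_i$ are the optimal Lagrange multipliers of the power balance equalities in that problem: there are multipliers $\mu_{ij}\ge0$ for the line constraints such that for $n\in\mathcal N_i$: $\pi_i$ lies between the left and right derivatives of $b_n$ at $x_n$ if $x_n>0$, and $\pi_i$ is at most the right derivative of $b_n$ at $0$ if $x_n=0$; $\sum_jY_{ij}(\pi_i-\pi_j+\mu_{ij}-\mu_{ji})=0$ for all $i$; and $\mu_{ij}[Y_{ij}(\theta_i-\theta_j)-C_{ij}]=0$ for all $(i,j)$. If the optimal $\pi$ is not unique, the lexicographically smallest one is used (first minimize $\pi_1$, then $\pi_2$, and so on). If the optimal $x$ is not unique, any optimal $x$ may be the dispatch associated with $b$. The pair $(x,\pi)$ is an outcome associated with $b$. The payoff of generator $n\in\mathcal N_i$ is $u_n=\pi_ix_n-c_n(x_n)$. A (pure) Nash equilibrium is a bid profile $b$ together with an associated outcome $(x,\pi)$ such that no generator can be strictly better off by a unilateral change of his bid (that is, for no generator $n$ and no alternative bid of $n$ does an outcome associated with the changed profile give $n$ a strictly larger payoff). Price of anarchy: $\mathrm{PoA}=\dfrac{\sup_x\sum_nc_n(x_n)}{\sum_nc_n(x_n^* )}$, the supremum being over all dispatches $x$ associated with Nash equilibria of the LMP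 game. *)

theory Defs
  imports Complex_Main "HOL-Library.Extended_Real"
begin

text \<open>
  Nodes are the numbers \<open>1, \<dots>, num_nodes\<close> and generators the numbers \<open>1, \<dots>, num_gens\<close>;
  values of the functions below outside these ranges are irrelevant.
  The set of generators at node \<open>i\<close> is encoded by the location map \<open>node_of\<close>.
\<close>

record network =
  num_nodes :: nat
  num_gens :: nat
  adm :: "nat \<Rightarrow> nat \<Rightarrow> real"
  cap :: "nat \<Rightarrow> nat \<Rightarrow> real"
  node_of :: "nat \<Rightarrow> nat"
  gen_cost :: "nat \<Rightarrow> real \<Rightarrow> real"
  demand :: "nat \<Rightarrow> real"

definition nodes :: "network \<Rightarrow> nat set" where
  "nodes G = {1..num_nodes G}"

definition gens :: "network \<Rightarrow> nat set" where
  "gens G = {1..num_gens G}"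

definition gens_at :: "network \<Rightarrow> nat \<Rightarrow> nat set" where
  "gens_at G i = {n \<in> gens G. node_of G n = i}"

definition lines :: "network \<Rightarrow> (nat \<times> nat) set" where
  "lines G = {(i, j). i \<in> nodes G \<and> j \<in> nodes G \<and> adm G i j > 0}"

definition admissible_cost :: "(real \<Rightarrow> real) \<Rightarrow> bool" where
  "admissible_cost c \<longleftrightarrow>
     c 0 = 0 \<and> (\<forall>x\<ge>0. c x \<ge> 0) \<and>
     (\<exists>c' c''. \<forall>x\<ge>0.
        (c has_real_derivative c' x) (at x within {0..}) \<and>
        (c' has_real_derivative c'' x) (at x within {0..}) \<and>
        c' x \<ge> 0 \<and> c'' x \<ge> 0)"

definition power_network :: "network \<Rightarrow> bool" where
  "power_network G \<longleftrightarrow>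
     (\<forall>i\<in>nodes G. \<forall>j\<in>nodes G. adm G i j \<ge> 0 \<and> adm G i j = adm G j i) \<and>
     (\<forall>i\<in>nodes G. adm G i i = 0) \<and>
     (\<forall>(i, j)\<in>lines G. cap G i j > 0 \<and> cap G i j = cap G j i) \<and>
     (\<forall>i\<in>nodes G. \<forall>j\<in>nodes G. (i, j) \<in> (lines G)\<^sup>*) \<and>
     (\<forall>n\<in>gens G. node_of G n \<in> nodes G \<and> admissible_cost (gen_cost G n)) \<and>
     (\<forall>i\<in>nodes G. demand G i \<ge> 0)"


section \<open>Economic dispatch\<close>

definition feasible :: "network \<Rightarrow> (nat \<Rightarrow> real) \<Rightarrow> (nat \<Rightarrow> real) \<Rightarrow> bool" where
  "feasible G x \<theta> \<longleftrightarrow>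
     (\<forall>i\<in>nodes G. (\<Sum>n\<in>gens_at G i. x n) - demand G i
                   = (\<Sum>j\<in>nodes G. adm G i j * (\<theta> i - \<theta> j))) \<and>
     (\<forall>(i, j)\<in>lines G. adm G i j * (\<theta> i - \<theta> j) \<le> cap G i j) \<and>
     (\<forall>n\<in>gens G. x n \<ge> 0)"

definition total_cost :: "network \<Rightarrow> (nat \<Rightarrow> real \<Rightarrow> real) \<Rightarrow> (nat \<Rightarrow> real) \<Rightarrow> real" where
  "total_cost G f x = (\<Sum>n\<in>gens G. f n (x n))"

definition ed_optimal ::
  "network \<Rightarrow> (nat \<Rightarrow> real \<Rightarrow> real) \<Rightarrow> (nat \<Rightarrow> real) \<Rightarrow> (nat \<Rightarrow> real) \<Rightarrow> bool" where
  "ed_optimal G f x \<theta> \<longleftrightarrow>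
     feasible G x \<theta> \<and>
     (\<forall>x' \<theta>'. feasible G x' \<theta>' \<longrightarrow> total_cost G f x \<le> total_cost G f x')"

definition optimal_dispatch :: "network \<Rightarrow> (nat \<Rightarrow> real) \<Rightarrow> bool" where
  "optimal_dispatch G x \<longleftrightarrow> (\<exists>\<theta>. ed_optimal G (gen_cost G) x \<theta>)"


section \<open>The LMP game\<close>

text \<open>A bid is a triple \<open>(p, s, q)\<close>.\<close>

type_synonym bid = "real \<times> real \<times> real"

definition valid_bid :: "bid \<Rightarrow> bool" where
  "valid_bid = (\<lambda>(p, s, q). 0 \<le> p \<and> p \<le> q \<and> 0 \<le> s)"

definition bid_fun :: "bid \<Rightarrow> real \<Rightarrow> real" where
  "bid_fun = (\<lambda>(p, s, q) x. if x \<le> s then p * x else q * x + (p - q) * s)"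

text \<open>
  Optimal Lagrange multipliers \<open>\<pi>\<close> of the power balance equalities, for the economic dispatch
  problem with cost functions \<open>f\<close> and its optimal solution \<open>(x, \<theta>)\<close>.  Since that problem is convex,
  the set of these \<open>\<pi>\<close> is the same for every optimal solution.
\<close>

definition balance_multiplier ::
  "network \<Rightarrow> (nat \<Rightarrow> real \<Rightarrow> real) \<Rightarrow> (nat \<Rightarrow> real) \<Rightarrow> (nat \<Rightarrow> real) \<Rightarrow> (nat \<Rightarrow> real) \<Rightarrow> bool" where
  "balance_multiplier G f x \<theta> \<pi> \<longleftrightarrow>
     (\<exists>\<mu>.
       (\<forall>(i, j)\<in>lines G. \<mu> i j \<ge> 0) \<and>
       (\<forall>i\<in>nodes G. \<forall>n\<in>gens_at G i.
          (x n > 0 \<longrightarrow>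
             (\<exists>l r. (f n has_real_derivative l) (at_left (x n)) \<and>
                    (f n has_real_derivative r) (at_right (x n)) \<and> l \<le> \<pi> i \<and> \<pi> i \<le> r)) \<and>
          (x n = 0 \<longrightarrow>
             (\<exists>r. (f n has_real_derivative r) (at_right 0) \<and> \<pi> i \<le> r))) \<and>
       (\<forall>i\<in>nodes G. (\<Sum>j\<in>nodes G. adm G i j * (\<pi> i - \<pi> j + \<mu> i j - \<mu> j i)) = 0) \<and>
       (\<forall>(i, j)\<in>lines G. \<mu> i j * (adm G i j * (\<theta> i - \<theta> j) - cap G i j) = 0))"

definition lex_less :: "network \<Rightarrow> (nat \<Rightarrow> real) \<Rightarrow> (nat \<Rightarrow> real) \<Rightarrow> bool" where
  "lex_less G \<pi>' \<pi> \<longleftrightarrow>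
     (\<exists>i\<in>nodes G. \<pi>' i < \<pi> i \<and> (\<forall>j\<in>nodes G. j < i \<longrightarrow> \<pi>' j = \<pi> j))"

definition outcome :: "network \<Rightarrow> (nat \<Rightarrow> bid) \<Rightarrow> (nat \<Rightarrow> real) \<Rightarrow> (nat \<Rightarrow> real) \<Rightarrow> bool" where
  "outcome G b x \<pi> \<longleftrightarrow>
     (\<exists>\<theta>. ed_optimal G (\<lambda>n. bid_fun (b n)) x \<theta> \<and>
          balance_multiplier G (\<lambda>n. bid_fun (b n)) x \<theta> \<pi> \<and>
          (\<nexists>\<pi>'. balance_multiplier G (\<lambda>n. bid_fun (b n)) x \<theta> \<pi>' \<and> lex_less G \<pi>' \<pi>))"

definition payoff :: "network \<Rightarrow> nat \<Rightarrow> (nat \<Rightarrow> real) \<Rightarrow> (nat \<Rightarrow> real) \<Rightarrow> real" where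
  "payoff G n x \<pi> = \<pi> (node_of G n) * x n - gen_cost G n (x n)"

text \<open>
  As bids are identified with functions on the nonnegative reals, an alternative bid is one whose
  function differs there: \<open>(p, s, p)\<close> and \<open>(p, s', p)\<close> are the same bid.
\<close>

definition nash_equilibrium ::
  "network \<Rightarrow> (nat \<Rightarrow> bid) \<Rightarrow> (nat \<Rightarrow> real) \<Rightarrow> (nat \<Rightarrow> real) \<Rightarrow> bool" where
  "nash_equilibrium G b x \<pi> \<longleftrightarrow>
     (\<forall>n\<in>gens G. valid_bid (b n)) \<and>
     outcome G b x \<pi> \<and>
     (\<forall>n\<in>gens G. \<forall>\<beta>. valid_bid \<beta> \<and> (\<exists>t\<ge>0. bid_fun \<beta> t \<noteq> bid_fun (b n) t) \<longrightarrow>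
        \<not> (\<exists>x' \<pi>'. outcome G (b(n := \<beta>)) x' \<pi>' \<and> payoff G n x' \<pi>' > payoff G n x \<pi>))"

text \<open>
  The supremum is taken in the extended reals, so it is \<open>-\<infinity>\<close> if there is no equilibrium.
  All optimal dispatches have the same total cost, so the choice in the denominator is immaterial.
\<close>

definition price_of_anarchy :: "network \<Rightarrow> ereal" where
  "price_of_anarchy G =
     (SUP x \<in> {x. \<exists>b \<pi>. nash_equilibrium G b x \<pi>}. ereal (total_cost G (gen_cost G) x))
     / ereal (total_cost G (gen_cost G) (SOME x. optimal_dispatch G x))"


section \<open>The two-node network\<close>

definition two_node_network :: "real \<Rightarrow> real \<Rightarrow> real \<Rightarrow> network" where
  "two_node_network Y C k =
     \<lparr> num_nodes = 2,
       num_gens = 4,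
       adm = (\<lambda>i j. if (i, j) = (1, 2) \<or> (i, j) = (2, 1) then Y else 0),
       cap = (\<lambda>i j. C),
       node_of = (\<lambda>n. if n = 1 \<or> n = 4 then 1 else 2),
       gen_cost = (\<lambda>n x. if n = 1 then x else if n = 4 then 2 * k * x else k * x),
       demand = (\<lambda>i. if i = 1 then 2 * C else 0) \<rparr>"

end

theory Submission imports Defs begin

text \<open>
  Let generators 1 and 4 bid the constant marginal price \<open>2 * k\<close> and generators 2 and 3 the constant
  marginal price \<open>k\<close>, and choose the dispatch \<open>x = (C, C, 0, 0)\<close>.  The line is congested, the prices
  are \<open>(2 * k, k)\<close>, and the cost is \<open>(k + 1) * C\<close>, while generator 1 alone could serve the demand
  at cost \<open>2 * C\<close>.  At each node a competitor with a constant bid caps the price, so generators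
  2, 3 and 4 never make a profit.  Generator 1 can sell at most \<open>C\<close> at a price of at most \<open>2 * k\<close>; to
  sell more it has to relieve the congestion, which lowers its price to at most \<open>k\<close> and its
  payoff to at most \<open>2 * C * (k - 1) < C * (2 * k - 1)\<close>.
\<close>

section \<open>Prices under bids with constant marginal price\<close>

lemma bid_fun_flat: "bid_fun (p, s, p) = (\<lambda>x. p * x)"
  by (auto simp: bid_fun_def)

lemma linear_right_derivative_unique:
  assumes "((\<lambda>x. p * x) has_real_derivative r) (at_right a)"
  shows "r = p"
proof -
  have "((\<lambda>x. p * x) has_real_derivative p) (at_right a)"
    by (auto intro!: derivative_eq_intros)
  with assms show ?thesis
    unfolding has_field_derivative_iff
    using tendsto_unique trivial_limit_at_right_real by blast
qed

lemma linear_left_derivative_unique: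
  assumes "((\<lambda>x. p * x) has_real_derivative l) (at_left a)"
  shows "l = p"
proof -
  have "((\<lambda>x. p * x) has_real_derivative p) (at_left a)"
    by (auto intro!: derivative_eq_intros)
  with assms show ?thesis
    unfolding has_field_derivative_iff
    using tendsto_unique trivial_limit_at_left_real by blast
qed

text \<open>Whether or not \<open>n\<close> is dispatched, the right derivative of its bid bounds
  the price at its node from above. Hence even an idle flat bidder caps the price.\<close>

lemma multiplier_le_flat:
  assumes "balance_multiplier G f x \<theta> \<pi>" "i \<in> nodes G" "n \<in> gens_at G i"
    and "f n = (\<lambda>x. p * x)" "x n \<ge> 0"
  shows "\<pi> i \<le> p"
proof -
  \<comment> \<open>A linear function has the same slope everywhere, so the point \<open>a\<close>
    may be forgotten and the two cases merge.\<close>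
  have "\<exists>a r. (f n has_real_derivative r) (at_right a) \<and> \<pi> i \<le> r"
    using assms unfolding balance_multiplier_def by (metis less_eq_real_def)
  then show ?thesis
    using assms(4) linear_right_derivative_unique by metis
qed

lemma multiplier_eq_flat:
  assumes "balance_multiplier G f x \<theta> \<pi>" "i \<in> nodes G" "n \<in> gens_at G i"
    and "f n = (\<lambda>x. p * x)" "x n > 0"
  shows "\<pi> i = p"
proof -
  have "\<exists>a l. (f n has_real_derivative l) (at_left a) \<and> l \<le> \<pi> i"
    using assms unfolding balance_multiplier_def by meson
  then have "p \<le> \<pi> i"
    using assms(4) linear_left_derivative_unique by metis
  moreover have "\<pi> i \<le> p"
    using multiplier_le_flat[OF assms(1-4)] assms(5) by simp
  ultimately show ?thesis by simp
qed

lemma admissible_cost_linear: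
  assumes "a \<ge> 0"
  shows "admissible_cost (\<lambda>x. a * x)"
  unfolding admissible_cost_def
proof (intro conjI)
  show "\<exists>c' c''. \<forall>x\<ge>0. ((\<lambda>x. a * x) has_real_derivative c' x) (at x within {0..}) \<and>
      (c' has_real_derivative c'' x) (at x within {0..}) \<and> c' x \<ge> 0 \<and> c'' x \<ge> 0"
    by (rule exI[of _ "\<lambda>_. a"], rule exI[of _ "\<lambda>_. 0"])
      (use assms in \<open>auto intro!: derivative_eq_intros\<close>)
qed (use assms in auto)

section \<open>The two-node network and its optimal cost\<close>

locale two_node =
  fixes Y C k :: real
  assumes Y: "Y > 0" and C: "C > 0" and k: "k > 1"
begin

abbreviation "G \<equiv> two_node_network Y C k"

lemma nodes_G: "nodes G = {1, 2}"
  by (auto simp: nodes_def two_node_network_def)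

lemma gens_G: "gens G = {1, 2, 3, 4}"
  by (auto simp: gens_def two_node_network_def)

text \<open>Node 1 appears as \<open>Suc 0\<close> because this is the simplifier's normal form of
  \<open>1\<close>.\<close>

lemma gens_at_G: "gens_at G (Suc 0) = {1, 4}" "gens_at G 2 = {2, 3}"
  by (auto simp: gens_at_def gens_G) (auto simp: two_node_network_def)

lemma lines_G: "lines G = {(1, 2), (2, 1)}"
  using Y by (auto simp: lines_def nodes_G) (auto simp: two_node_network_def split: if_splits)

lemma power_network_G: "power_network G"
proof -
  have cost: "admissible_cost (gen_cost G n)" for n
  proof -
    have "gen_cost G n = (\<lambda>x. (if n = 1 then 1 else if n = 4 then 2 * k else k) * x)"
      by (auto simp: two_node_network_def)
    then show ?thesis using k by (simp add: admissible_cost_linear)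
  qed
  show ?thesis
    unfolding power_network_def lines_G gens_G nodes_G
    using Y C cost by (auto simp: two_node_network_def)
qed

lemma feasible_G:
  "feasible G x \<theta> \<longleftrightarrow>
     x 1 + x 4 - 2 * C = Y * (\<theta> 1 - \<theta> 2) \<and> x 2 + x 3 = Y * (\<theta> 2 - \<theta> 1) \<and>
     Y * (\<theta> 1 - \<theta> 2) \<le> C \<and> Y * (\<theta> 2 - \<theta> 1) \<le> C \<and>
     x 1 \<ge> 0 \<and> x 2 \<ge> 0 \<and> x 3 \<ge> 0 \<and> x 4 \<ge> 0"
  unfolding feasible_def nodes_G gens_G lines_G
  by (auto simp: gens_at_G) (auto simp: two_node_network_def)

lemma total_cost_G: "total_cost G f x = f 1 (x 1) + f 2 (x 2) + f 3 (x 3) + f 4 (x 4)"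
  by (simp add: total_cost_def gens_G)

lemma gen_cost_G: "gen_cost G = (\<lambda>n x. if n = 1 then x else if n = 4 then 2 * k * x else k * x)"
  by (simp add: two_node_network_def)

text \<open>Adding the two balance equations cancels the line flow.\<close>

lemma feasible_sum:
  assumes "feasible G x \<theta>"
  shows "x 1 + x 2 + x 3 + x 4 = 2 * C"
  using assms unfolding feasible_G by (simp add: algebra_simps)

text \<open>Since \<open>k > 1\<close>, every unit of the demand \<open>2 * C\<close> costs at least
  1.\<close>

lemma total_cost_ge:
  assumes "feasible G x \<theta>"
  shows "2 * C \<le> total_cost G (gen_cost G) x"
proof -
  have nonneg: "x 2 \<ge> 0" "x 3 \<ge> 0" "x 4 \<ge> 0"
    using assms by (auto simp: feasible_G)
  have scale: "t \<le> a * t" if "1 \<le> a" "0 \<le> t" for a t :: real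
    using mult_right_mono[OF that] by simp
  have "x 2 \<le> k * x 2" "x 3 \<le> k * x 3" "x 4 \<le> 2 * k * x 4"
    using nonneg k by (auto intro!: scale)
  then show ?thesis
    using feasible_sum[OF assms] by (simp add: total_cost_G gen_cost_G)
qed

lemma optimal_dispatch_exists: "\<exists>x. optimal_dispatch G x"
proof -
  have "feasible G (\<lambda>n. if n = 1 then 2 * C else 0) (\<lambda>_. 0)"
    using C by (simp add: feasible_G)
  moreover have "total_cost G (gen_cost G) (\<lambda>n. if n = 1 then 2 * C else 0) = 2 * C"
    by (simp add: total_cost_G gen_cost_G)
  ultimately show ?thesis
    unfolding optimal_dispatch_def ed_optimal_def using total_cost_ge by metis
qed

lemma optimal_cost:
  assumes "optimal_dispatch G x"
  shows "total_cost G (gen_cost G) x = 2 * C"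
proof -
  obtain \<theta> where x: "feasible G x \<theta>"
    and opt: "\<And>x' \<theta>'. feasible G x' \<theta>' \<Longrightarrow> total_cost G (gen_cost G) x \<le> total_cost G (gen_cost G) x'"
    using assms unfolding optimal_dispatch_def ed_optimal_def by blast
  have "feasible G (\<lambda>n. if n = 1 then 2 * C else 0) (\<lambda>_. 0)"
    using C by (simp add: feasible_G)
  from opt[OF this] have "total_cost G (gen_cost G) x \<le> 2 * C"
    by (simp add: total_cost_G gen_cost_G)
  moreover have "2 * C \<le> total_cost G (gen_cost G) x"
    using total_cost_ge[OF x] by simp
  ultimately show ?thesis by simp
qed

section \<open>The equilibrium bids and their outcome\<close>

definition eq_bid :: "nat \<Rightarrow> bid" where
  "eq_bid n = (if n = 1 \<or> n = 4 then (2 * k, 0, 2 * k) else (k, 0, k))"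

definition eq_dispatch :: "nat \<Rightarrow> real" where
  "eq_dispatch n = (if n = 1 \<or> n = 2 then C else 0)"

definition eq_price :: "nat \<Rightarrow> real" where
  "eq_price i = (if i = 1 then 2 * k else k)"

text \<open>The gap \<open>C / Y\<close> makes the flow from node 2 to node 1 exactly
  \<open>C\<close>.\<close>

definition eq_angle :: "nat \<Rightarrow> real" where
  "eq_angle i = (if i = 2 then C / Y else 0)"

lemma bid_fun_eq_bid:
  "bid_fun (eq_bid n) = (\<lambda>x. (if n = 1 \<or> n = 4 then 2 * k else k) * x)"
  by (simp add: eq_bid_def bid_fun_flat)

text \<open>Generators 1 and 2 are both dispatched, which pins the price at each node; the
  lexicographic choice is then vacuous.\<close>

lemma eq_multiplier_unique:
  assumes "balance_multiplier G (\<lambda>n. bid_fun (eq_bid n)) eq_dispatch \<theta> \<pi>"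
  shows "\<pi> 1 = 2 * k" "\<pi> 2 = k"
  using multiplier_eq_flat[OF assms, of 1 1 "2 * k"] multiplier_eq_flat[OF assms, of 2 2 k] C
  by (simp_all add: nodes_G gens_at_G bid_fun_eq_bid eq_dispatch_def)

lemma eq_multiplier:
  "balance_multiplier G (\<lambda>n. bid_fun (eq_bid n)) eq_dispatch eq_angle eq_price"
proof -
  have deriv: "(bid_fun (eq_bid n) has_real_derivative eq_price i) (at a within S)"
    if "i \<in> nodes G" "n \<in> gens_at G i" for i n a S
    using that unfolding bid_fun_eq_bid
    by (auto simp: nodes_G gens_at_G eq_price_def intro!: derivative_eq_intros)
  show ?thesis
    unfolding balance_multiplier_def
  \<comment> \<open>By stationarity, the multiplier of the saturated direction from 2 to 1 must
    equal the price gap \<open>2 * k - k\<close>.\<close>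
  proof (rule exI[of _ "\<lambda>i j. if i = 2 then k else 0"], intro conjI)
    show "\<forall>(i, j)\<in>lines G. (if i = 2 then k else 0) \<ge> 0"
      using k by auto
    show "\<forall>i\<in>nodes G. \<forall>n\<in>gens_at G i.
          (eq_dispatch n > 0 \<longrightarrow>
             (\<exists>l r. (bid_fun (eq_bid n) has_real_derivative l) (at_left (eq_dispatch n)) \<and>
                    (bid_fun (eq_bid n) has_real_derivative r) (at_right (eq_dispatch n)) \<and>
                    l \<le> eq_price i \<and> eq_price i \<le> r)) \<and>
          (eq_dispatch n = 0 \<longrightarrow>
             (\<exists>r. (bid_fun (eq_bid n) has_real_derivative r) (at_right 0) \<and> eq_price i \<le> r))"
      using deriv by blast
    show "\<forall>i\<in>nodes G. (\<Sum>j\<in>nodes G. adm G i j *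
        (eq_price i - eq_price j + (if i = 2 then k else 0) - (if j = 2 then k else 0))) = 0"
      by (simp add: nodes_G eq_price_def)
    show "\<forall>(i, j)\<in>lines G. (if i = 2 then k else 0) *
        (adm G i j * (eq_angle i - eq_angle j) - cap G i j) = 0"
      using Y by (simp add: lines_G eq_angle_def) (simp add: two_node_network_def)
  qed
qed

text \<open>With total output \<open>2 * C\<close>, the bid cost is
  \<open>4 * k * C - k * (x 2 + x 3)\<close>, and the line limits \<open>x 2 + x 3\<close> to
  \<open>C\<close>.\<close>

lemma eq_ed_optimal: "ed_optimal G (\<lambda>n. bid_fun (eq_bid n)) eq_dispatch eq_angle"
  unfolding ed_optimal_def
proof (intro conjI allI impI)
  show "feasible G eq_dispatch eq_angle"
    using Y C by (simp add: feasible_G eq_dispatch_def eq_angle_def)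
next
  fix x \<theta> assume x: "feasible G x \<theta>"
  then have "x 2 + x 3 \<le> C" by (simp add: feasible_G)
  then have "k * (x 2 + x 3) \<le> k * C" using k by simp
  moreover have "2 * k * (x 1 + x 2 + x 3 + x 4) = 2 * k * (2 * C)"
    using feasible_sum[OF x] by simp
  ultimately show "total_cost G (\<lambda>n. bid_fun (eq_bid n)) eq_dispatch
      \<le> total_cost G (\<lambda>n. bid_fun (eq_bid n)) x"
    by (simp add: total_cost_G bid_fun_eq_bid eq_dispatch_def algebra_simps)
qed

lemma eq_outcome: "outcome G eq_bid eq_dispatch eq_price"
  unfolding outcome_def
proof (intro exI conjI)
  show "\<nexists>\<pi>. balance_multiplier G (\<lambda>n. bid_fun (eq_bid n)) eq_dispatch eq_angle \<pi> \<and>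
      lex_less G \<pi> eq_price"
    using eq_multiplier_unique
    by (fastforce simp: lex_less_def nodes_G eq_price_def)
qed (rule eq_ed_optimal eq_multiplier)+

section \<open>Prices and payoffs after a unilateral deviation\<close>

text \<open>Congestion from node 1 to node 2 is impossible because node 2 has no demand.\<close>

lemma price_equal_if_uncongested:
  assumes "balance_multiplier G f x \<theta> \<pi>" "feasible G x \<theta>" "x 2 + x 3 < C"
  shows "\<pi> 1 = \<pi> 2"
proof -
  obtain \<mu> where
    stat: "\<forall>i\<in>nodes G. (\<Sum>j\<in>nodes G. adm G i j * (\<pi> i - \<pi> j + \<mu> i j - \<mu> j i)) = 0"
    and slack: "\<forall>(i, j)\<in>lines G. \<mu> i j * (adm G i j * (\<theta> i - \<theta> j) - cap G i j) = 0"
    using assms(1) unfolding balance_multiplier_def by blast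
  have flow: "Y * (\<theta> 2 - \<theta> 1) < C" "Y * (\<theta> 1 - \<theta> 2) < C"
    using assms(2,3) C unfolding feasible_G by (simp_all add: algebra_simps)
  have "(1, 2) \<in> lines G" "(2, 1) \<in> lines G" "1 \<in> nodes G"
    by (simp_all add: lines_G nodes_G)
  then have inst: "\<mu> 1 2 * (adm G 1 2 * (\<theta> 1 - \<theta> 2) - cap G 1 2) = 0"
      "\<mu> 2 1 * (adm G 2 1 * (\<theta> 2 - \<theta> 1) - cap G 2 1) = 0"
      "(\<Sum>j\<in>nodes G. adm G 1 j * (\<pi> 1 - \<pi> j + \<mu> 1 j - \<mu> j 1)) = 0"
    using slack stat by blast+
  have "\<mu> 1 2 * (Y * (\<theta> 1 - \<theta> 2) - C) = 0" "\<mu> 2 1 * (Y * (\<theta> 2 - \<theta> 1) - C) = 0"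
    using inst(1,2) by (simp_all add: two_node_network_def)
  \<comment> \<open>Complementary slackness removes both line multipliers, so stationarity at node 1
    leaves only the price difference.\<close>
  then have "\<mu> 1 2 = 0" "\<mu> 2 1 = 0"
    using flow by auto
  moreover have "Y * (\<pi> 1 - \<pi> 2 + \<mu> 1 2 - \<mu> 2 1) = 0"
    using inst(3) unfolding nodes_G by (simp add: two_node_network_def)
  ultimately show ?thesis
    using Y by simp
qed

text \<open>Each node has two generators and only \<open>n\<close> deviates, so a flat bidder other
  than \<open>n\<close> remains at each node; the \<open>if\<close> selects it.\<close>

lemma price_cap:
  assumes "balance_multiplier G (\<lambda>m. bid_fun ((eq_bid(n := \<beta>)) m)) x \<theta> \<pi>" "feasible G x \<theta>"
  shows "\<pi> 1 \<le> 2 * k" "\<pi> 2 \<le> k"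
proof -
  have nonneg: "x 1 \<ge> 0" "x 2 \<ge> 0" "x 3 \<ge> 0" "x 4 \<ge> 0"
    using assms(2) by (simp_all add: feasible_G)
  show "\<pi> 1 \<le> 2 * k"
    using multiplier_le_flat[OF assms(1), of 1 "if n = 1 then 4 else 1" "2 * k"] nonneg
    by (auto simp: nodes_G gens_at_G bid_fun_eq_bid split: if_splits)
  show "\<pi> 2 \<le> k"
    using multiplier_le_flat[OF assms(1), of 2 "if n = 2 then 3 else 2" k] nonneg
    by (auto simp: nodes_G gens_at_G bid_fun_eq_bid split: if_splits)
qed

lemma eq_payoff: "payoff G 1 eq_dispatch eq_price = (2 * k - 1) * C"
    "n \<in> gens G \<Longrightarrow> n \<noteq> 1 \<Longrightarrow> payoff G n eq_dispatch eq_price = 0"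
  by (auto simp: gens_G payoff_def eq_dispatch_def eq_price_def two_node_network_def algebra_simps)

lemma deviation_payoff_le:
  assumes "n \<in> gens G" "outcome G (eq_bid(n := \<beta>)) x \<pi>"
  shows "payoff G n x \<pi> \<le> payoff G n eq_dispatch eq_price"
proof -
  obtain \<theta> where x: "feasible G x \<theta>"
    and mult: "balance_multiplier G (\<lambda>m. bid_fun ((eq_bid(n := \<beta>)) m)) x \<theta> \<pi>"
    using assms(2) unfolding outcome_def ed_optimal_def by blast
  have nonneg: "x 1 \<ge> 0" "x 2 \<ge> 0" "x 3 \<ge> 0" "x 4 \<ge> 0"
    using x by (simp_all add: feasible_G)
  note cap = price_cap[OF mult x]
  show ?thesis
  proof (cases "n = 1")
    case True
    have pay: "payoff G 1 x \<pi> = (\<pi> 1 - 1) * x 1"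
      by (simp add: payoff_def two_node_network_def algebra_simps)
    have "(\<pi> 1 - 1) * x 1 \<le> (2 * k - 1) * C"
    proof (cases "x 1 \<le> C")
      case True
      have "(\<pi> 1 - 1) * x 1 \<le> (2 * k - 1) * x 1"
        using cap(1) nonneg by (intro mult_right_mono) auto
      also have "\<dots> \<le> (2 * k - 1) * C"
        using True k by (intro mult_left_mono) auto
      finally show ?thesis .
    next
      case False
      then have "x 2 + x 3 < C"
        using feasible_sum[OF x] nonneg by linarith
      then have "\<pi> 1 \<le> k"
        using price_equal_if_uncongested[OF mult x] cap(2) by simp
      then have "(\<pi> 1 - 1) * x 1 \<le> (k - 1) * x 1"
        using nonneg by (intro mult_right_mono) auto
      also have "\<dots> \<le> (k - 1) * (2 * C)"
        using feasible_sum[OF x] nonneg k by (intro mult_left_mono) auto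
      \<comment> \<open>The right side exceeds the left by exactly \<open>C\<close>.\<close>
      also have "\<dots> \<le> (2 * k - 1) * C"
        using C by (simp add: algebra_simps)
      finally show ?thesis .
    qed
    then show ?thesis using True pay eq_payoff(1) by simp
  next
    case False
    then consider "n = 2" | "n = 3" | "n = 4"
      using assms(1) by (auto simp: gens_G)
    \<comment> \<open>For generators 2, 3 and 4 the price cap at the node equals their own marginal
      cost.\<close>
    then have "payoff G n x \<pi> \<le> 0"
      by cases (use cap nonneg in
        \<open>simp_all add: payoff_def two_node_network_def mult_right_mono\<close>)
    then show ?thesis using eq_payoff(2)[OF assms(1) False] by simp
  qed
qed

lemma nash_equilibrium_eq: "nash_equilibrium G eq_bid eq_dispatch eq_price"
  unfolding nash_equilibrium_def
  using eq_outcome deviation_payoff_le k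
  by (auto simp: valid_bid_def eq_bid_def not_less simp flip: fun_upd_def)

lemma price_of_anarchy_ge: "price_of_anarchy G \<ge> ereal ((k + 1) / 2)"
proof -
  have opt: "total_cost G (gen_cost G) (SOME x. optimal_dispatch G x) = 2 * C"
    using optimal_cost someI_ex[OF optimal_dispatch_exists] by blast
  have cost: "total_cost G (gen_cost G) eq_dispatch = (k + 1) * C"
    by (simp add: total_cost_G gen_cost_G eq_dispatch_def algebra_simps)
  have "ereal ((k + 1) / 2) = ereal ((k + 1) * C) / ereal (2 * C)"
    using C by simp
  also have "\<dots> \<le> price_of_anarchy G"
    unfolding price_of_anarchy_def opt
    \<comment> \<open>A single equilibrium bounds the supremum from below, and
      \<open>2 * C > 0\<close> makes the division monotone.\<close>
    using nash_equilibrium_eq C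
    by (intro ereal_divide_right_mono SUP_upper2[of eq_dispatch]) (auto simp: cost)
  finally show ?thesis .
qed

end

theorem mainTheorem3:
  fixes Y C :: real
  assumes "Y > 0" and "C > 0"
  shows "(\<forall>k>1. power_network (two_node_network Y C k) \<and>
                price_of_anarchy (two_node_network Y C k) \<ge> ereal ((k + 1) / 2)) \<and>
         ((\<lambda>k. price_of_anarchy (two_node_network Y C k)) \<longlongrightarrow> \<infinity>) at_top"
proof (intro conjI allI impI)
  fix k :: real assume "k > 1"
  then interpret two_node Y C k
    using assms by unfold_locales
  show "power_network G" "price_of_anarchy G \<ge> ereal ((k + 1) / 2)"
    by (rule power_network_G price_of_anarchy_ge)+
next
  show "((\<lambda>k. price_of_anarchy (two_node_network Y C k)) \<longlongrightarrow> \<infinity>) at_top"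
    unfolding tendsto_PInfty
  proof
    fix r :: real
    show "\<forall>\<^sub>F k in at_top. ereal r < price_of_anarchy (two_node_network Y C k)"
      \<comment> \<open>\<open>k > 1\<close> admits the locale, and \<open>k > 2 * r\<close> gives
        \<open>r < (k + 1) / 2\<close>.\<close>
      using eventually_gt_at_top[of "max 1 (2 * r)"]
    proof eventually_elim
      case (elim k)
      then have "ereal r < ereal ((k + 1) / 2)" by simp
      also have "\<dots> \<le> price_of_anarchy (two_node_network Y C k)"
        using elim assms by (intro two_node.price_of_anarchy_ge two_node.intro) auto
      finally show ?case .
    qed
  qed
qed

end
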